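(* Let $G$ be a connected graph. Then $tmc(G)=4$ if and only if either $G$ is a tree with $l(G)=3$, or $G$ is a cycle other than $K_3$ (i.e. a cycle of length at least $4$).
   Context: All graphs are simple, finite and undirected. A graph is total-colored if all its edges and all its vertices are assigned colors. A path in a total-colored graph is a total monochromatic path if all its edges and all its internal vertices have the same color. A total-coloring is a TMC-coloring if any two vertices are connected by a total monochromatic path. For a connected graph $G$, $tmc(G)$ is the maximum number of colors used in a TMC-coloring of $G$. A leaf of a tree is a vertex of degree one; for a tree $T$, $l(T)$ is its number of leaves, and for a connected graph $G$, $l(G)=\max\{l(T): T \text{ a spanning tree of } G\}$. *)

theory Defs
  imports Main
begin

text \<open>
  A graph is given by its vertex set \<open>V\<close> and its set \<open>E\<close> of two-element edges.
\<close>

definition simple_graph :: "'a set \<Rightarrow> 'a set set \<Rightarrow> bool" where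
  "simple_graph V E \<longleftrightarrow> finite V \<and> (\<forall>e\<in>E. e \<subseteq> V \<and> card e = 2)"

fun walk_edges :: "'a list \<Rightarrow> 'a set list" where
  "walk_edges [] = []"
| "walk_edges [x] = []"
| "walk_edges (x # y # zs) = {x, y} # walk_edges (y # zs)"

definition graph_path :: "'a set \<Rightarrow> 'a set set \<Rightarrow> 'a \<Rightarrow> 'a list \<Rightarrow> 'a \<Rightarrow> bool" where
  "graph_path V E u p v \<longleftrightarrow>
     p \<noteq> [] \<and> hd p = u \<and> last p = v \<and> distinct p \<and> set p \<subseteq> V \<and> set (walk_edges p) \<subseteq> E"

definition connected_graph :: "'a set \<Rightarrow> 'a set set \<Rightarrow> bool" where
  "connected_graph V E \<longleftrightarrow> V \<noteq> {} \<and> (\<forall>u\<in>V. \<forall>v\<in>V. \<exists>p. graph_path V E u p v)"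

text \<open>
  A cycle is represented by the list of its vertices in cyclic order, without repeating the
  first one at the end.
\<close>

definition cycle_edges :: "'a list \<Rightarrow> 'a set set" where
  "cycle_edges p = set (walk_edges (p @ [hd p]))"

definition cycle_list :: "'a list \<Rightarrow> bool" where
  "cycle_list p \<longleftrightarrow> 3 \<le> length p \<and> distinct p"

definition cycle_graph :: "'a set \<Rightarrow> 'a set set \<Rightarrow> bool" where
  "cycle_graph V E \<longleftrightarrow> (\<exists>p. cycle_list p \<and> V = set p \<and> E = cycle_edges p)"

definition acyclic_graph :: "'a set \<Rightarrow> 'a set set \<Rightarrow> bool" where
  "acyclic_graph V E \<longleftrightarrow> \<not> (\<exists>p. cycle_list p \<and> set p \<subseteq> V \<and> cycle_edges p \<subseteq> E)"

definition tree_graph :: "'a set \<Rightarrow> 'a set set \<Rightarrow> bool" where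
  "tree_graph V E \<longleftrightarrow> connected_graph V E \<and> acyclic_graph V E"

definition vertex_degree :: "'a set set \<Rightarrow> 'a \<Rightarrow> nat" where
  "vertex_degree E v = card {e \<in> E. v \<in> e}"

definition num_leaves :: "'a set \<Rightarrow> 'a set set \<Rightarrow> nat" where
  "num_leaves V E = card {v \<in> V. vertex_degree E v = 1}"

text \<open>
  A spanning tree of \<open>(V, E)\<close> is determined by its edge set \<open>F\<close>. For a finite connected graph
  there are finitely many, and at least one, so the maximum is meaningful.
\<close>

definition max_leaves :: "'a set \<Rightarrow> 'a set set \<Rightarrow> nat" where
  "max_leaves V E = Max {num_leaves V F | F. F \<subseteq> E \<and> tree_graph V F}"

text \<open>
  A total coloring consists of a vertex coloring \<open>vc\<close> and an edge coloring \<open>ec\<close> with a common set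
  of colors; natural numbers suffice since the graphs are finite. Values outside \<open>V\<close> and \<open>E\<close>
  are irrelevant. The internal vertices of a path \<open>p\<close> are \<open>butlast (tl p)\<close>.
\<close>

definition total_mono_path ::
  "'a set \<Rightarrow> 'a set set \<Rightarrow> ('a \<Rightarrow> nat) \<Rightarrow> ('a set \<Rightarrow> nat) \<Rightarrow> 'a \<Rightarrow> 'a list \<Rightarrow> 'a \<Rightarrow> bool" where
  "total_mono_path V E vc ec u p v \<longleftrightarrow>
     graph_path V E u p v \<and>
     (\<exists>c. (\<forall>e\<in>set (walk_edges p). ec e = c) \<and> (\<forall>w\<in>set (butlast (tl p)). vc w = c))"

definition tmc_coloring ::
  "'a set \<Rightarrow> 'a set set \<Rightarrow> ('a \<Rightarrow> nat) \<Rightarrow> ('a set \<Rightarrow> nat) \<Rightarrow> bool" where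
  "tmc_coloring V E vc ec \<longleftrightarrow> (\<forall>u\<in>V. \<forall>v\<in>V. \<exists>p. total_mono_path V E vc ec u p v)"

definition colors_used ::
  "'a set \<Rightarrow> 'a set set \<Rightarrow> ('a \<Rightarrow> nat) \<Rightarrow> ('a set \<Rightarrow> nat) \<Rightarrow> nat set" where
  "colors_used V E vc ec = vc ` V \<union> ec ` E"

text \<open>
  The maximum ranges over numbers at most \<open>card V + card E\<close>, and constant colorings of a
  connected graph are TMC-colorings.
\<close>

definition tmc :: "'a set \<Rightarrow> 'a set set \<Rightarrow> nat" where
  "tmc V E = Max {card (colors_used V E vc ec) | vc ec. tmc_coloring V E vc ec}"

end

theory Submission
  imports Defs
begin

text \<open>
  Let every two vertices be joined inside \<open>F \<subseteq> E\<close> by a path with no internal vertex in \<open>L\<close>. Giving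
  one color to \<open>F\<close> and \<open>V - L\<close>, and private colors to the rest, uses \<open>1 + |L| + |E - F|\<close> colors.
  In a tree, paths are unique, which forces all edges and all vertices that are not leaves to share
  a color; so \<open>F = E\<close> and \<open>L\<close> the set of leaves is optimal.

  If \<open>G\<close> has a cycle, some edge of the cycle can be deleted, and a star with \<open>k\<close> leaves at a cycle
  vertex away from that edge grows to all of \<open>V\<close> keeping \<open>|L| = k\<close>. This gives \<open>k + 2\<close> colors, where
  \<open>k = 2\<close> is always possible and \<open>k = 3\<close> unless \<open>G\<close> is a cycle. In a cycle of length at least 4,
  either both edges at every vertex \<open>b\<close> have the color of \<open>b\<close>, so there is only one color, or for some
  \<open>b\<close> the neighbours of \<open>b\<close> are joined the long way round, and the pair of vertices at distance two
  next to it saves two of the remaining six colors.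
\<close>

section \<open>Walks and paths\<close>

lemma walk_edges_Cons: "p \<noteq> [] \<Longrightarrow> walk_edges (x # p) = {x, hd p} # walk_edges p"
  by (cases p) auto

lemma walk_edges_append: "walk_edges (xs @ x # ys) = walk_edges (xs @ [x]) @ walk_edges (x # ys)"
  by (induction xs rule: walk_edges.induct) auto

lemma walk_edges_snoc: "p \<noteq> [] \<Longrightarrow> walk_edges (p @ [x]) = walk_edges p @ [{last p, x}]"
  by (induction p rule: walk_edges.induct) auto

lemma walk_edges_subset: "e \<in> set (walk_edges p) \<Longrightarrow> e \<subseteq> set p"
  by (induction p rule: walk_edges.induct) auto

text \<open>A discrete intermediate value principle: a walk that starts in \<open>S\<close> and ends
  outside has to leave \<open>S\<close> along one of its edges. The cut arguments below rest on
  it.\<close>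

lemma walk_edges_crossing:
  assumes "p \<noteq> []" "hd p \<in> S" "last p \<notin> S"
  shows "\<exists>x y. {x, y} \<in> set (walk_edges p) \<and> x \<in> S \<and> y \<notin> S"
  using assms
proof (induction p rule: walk_edges.induct)
  case (3 x y zs)
  then show ?case by (cases "y \<in> S") auto
qed auto

lemma in_walk_edges_split:
  "e \<in> set (walk_edges p) \<Longrightarrow> \<exists>xs x y ys. p = xs @ x # y # ys \<and> e = {x, y}"
proof (induction p rule: walk_edges.induct)
  case (3 x y zs)
  show ?case
  proof (cases "e = {x, y}")
    case True
    then show ?thesis by (metis append_Nil)
  next
    case False
    with 3 obtain xs u v ys where "y # zs = xs @ u # v # ys" "e = {u, v}" by auto
    then show ?thesis by (metis append_Cons)
  qed
qed auto

lemma in_inner_split: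
  assumes "x \<in> set (butlast (tl p))"
  shows "\<exists>ys y z zs. p = ys @ y # x # z # zs"
proof -
  from assms have "tl p \<noteq> []" by auto
  then obtain h t l where p: "p = h # t @ [l]"
    by (metis append_butlast_last_id list.collapse tl_Nil)
  with assms have "x \<in> set t" by simp
  then obtain a b where t: "t = a @ x # b" by (meson split_list)
  obtain a' y where "h # a = a' @ [y]" by (metis list.distinct(1) rev_exhaust)
  moreover obtain z b' where "b @ [l] = z # b'" by (metis append_is_Nil_conv list.exhaust not_Cons_self2)
  ultimately have "p = a' @ y # x # z # b'" using p t
    by (metis append.assoc append_Cons append_Nil)
  then show ?thesis by blast
qed

lemma set_inner:
  assumes "x \<in> set p" "x \<noteq> hd p" "x \<noteq> last p"
  shows "x \<in> set (butlast (tl p))"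
proof -
  have "x \<in> set (tl p)" using assms(1,2) by (cases p) auto
  then show ?thesis using assms(3)
    by (metis append_butlast_last_id empty_iff empty_set last_tl rotate1.simps(2) set_ConsD set_rotate1)
qed

lemma graph_path_singleton: "u \<in> V \<Longrightarrow> graph_path V E u [u] u"
  by (simp add: graph_path_def)

lemma graph_path_edge:
  "{u, v} \<in> E \<Longrightarrow> u \<in> V \<Longrightarrow> v \<in> V \<Longrightarrow> u \<noteq> v \<Longrightarrow> graph_path V E u [u, v] v"
  by (simp add: graph_path_def)

lemma graph_path_mono: "graph_path V F u p v \<Longrightarrow> F \<subseteq> E \<Longrightarrow> graph_path V E u p v"
  by (auto simp: graph_path_def)

lemma simple_graph_edgeE:
  assumes "simple_graph V E" "e \<in> E"
  obtains x y where "e = {x, y}" "x \<noteq> y" "x \<in> V" "y \<in> V"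
  using assms by (auto simp: simple_graph_def card_2_iff)

lemma simple_graph_edge_at:
  assumes "simple_graph V E" "e \<in> E" "v \<in> e"
  shows "\<exists>w. e = {v, w}"
proof -
  obtain x y where "e = {x, y}" using simple_graph_edgeE[OF assms(1,2)] by metis
  then show ?thesis using assms(3) by auto
qed

lemma simple_graph_finite:
  assumes "simple_graph V E" shows "finite V" "finite E"
  using assms finite_subset[of E "Pow V"] by (auto simp: simple_graph_def)

section \<open>Connectivity through edge cuts\<close>

text \<open>This form of connectivity can be verified for a subgraph without building paths, and it
  directly supplies the next vertex when a connected piece is grown.\<close>

definition all_cuts_crossed :: "'a set \<Rightarrow> 'a set set \<Rightarrow> bool" where
  "all_cuts_crossed V F \<longleftrightarrow>
     (\<forall>S. S \<subset> V \<longrightarrow> S \<noteq> {} \<longrightarrow> (\<exists>x y. {x, y} \<in> F \<and> x \<in> S \<and> y \<in> V - S))"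

lemma connected_graph_all_cuts_crossed:
  assumes "connected_graph V E"
  shows "all_cuts_crossed V E"
  unfolding all_cuts_crossed_def
proof (intro allI impI)
  fix S assume S: "S \<subset> V" "S \<noteq> {}"
  then obtain u v where uv: "u \<in> S" "v \<in> V - S" "u \<in> V" by blast
  with assms obtain p where p: "graph_path V E u p v" by (auto simp: connected_graph_def)
  then obtain x y where xy: "{x, y} \<in> set (walk_edges p)" "x \<in> S" "y \<notin> S"
    using walk_edges_crossing[of p S] uv by (auto simp: graph_path_def)
  then have "{x, y} \<subseteq> set p" using walk_edges_subset by blast
  then show "\<exists>x y. {x, y} \<in> E \<and> x \<in> S \<and> y \<in> V - S"
    using xy p unfolding graph_path_def by blast
qed

section \<open>Cycles\<close>

lemma cycle_edges_rotate1: "cycle_edges (rotate1 p) = cycle_edges p"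
proof (cases p rule: walk_edges.cases)
  case (3 x y zs)
  then show ?thesis
    using walk_edges_snoc[of "y # zs @ [x]" y] by (simp add: cycle_edges_def)
qed simp_all

lemma cycle_edges_rotate: "cycle_edges (rotate n p) = cycle_edges p"
  by (induction n) (simp_all add: cycle_edges_rotate1)

lemma cycle_edges_eq: "p \<noteq> [] \<Longrightarrow> cycle_edges p = insert {last p, hd p} (set (walk_edges p))"
  by (simp add: cycle_edges_def walk_edges_snoc)

lemma cycle_edges_subset: "e \<in> cycle_edges p \<Longrightarrow> e \<subseteq> set p"
  unfolding cycle_edges_def using walk_edges_subset[of e "p @ [hd p]"]
  by (cases p) auto

text \<open>The shape \<open>x # a # b # r\<close> exhibits a cycle edge \<open>{a, b}\<close> that
  does not contain the chosen vertex \<open>x\<close>.\<close>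

lemma cycle_list_rotate_to:
  assumes "cycle_list p" "x \<in> set p"
  obtains a b r where "cycle_list (x # a # b # r)" "set (x # a # b # r) = set p"
    "cycle_edges (x # a # b # r) = cycle_edges p"
proof -
  from assms(2) obtain xs ys where p: "p = xs @ x # ys" by (meson split_list)
  define q where "q = rotate (length xs) p"
  have q: "q = x # ys @ xs" by (simp add: q_def p rotate_append)
  have len: "length q = length p" by (simp add: q_def)
  with assms(1) have "length (ys @ xs) \<ge> 2" by (simp add: cycle_list_def q)
  then obtain a b r where "ys @ xs = a # b # r"
    by (metis Suc_le_length_iff numeral_2_eq_2)
  then have "q = x # a # b # r" using q by simp
  moreover have "cycle_list q" "set q = set p" "cycle_edges q = cycle_edges p"
    using assms(1) by (simp_all add: q_def cycle_list_def cycle_edges_rotate)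
  ultimately show ?thesis using that by metis
qed

section \<open>Lower bounds\<close>

text \<open>If \<open>F\<close> and the vertices outside \<open>L\<close> share one color, the paths
  required here are total monochromatic. Their ends may lie in \<open>L\<close>, so \<open>L\<close>
  behaves like a set of leaves.\<close>

definition linked_avoiding :: "'a set \<Rightarrow> 'a set set \<Rightarrow> 'a set \<Rightarrow> bool" where
  "linked_avoiding V F L \<longleftrightarrow>
     (\<forall>u\<in>V. \<forall>v\<in>V. \<exists>p. graph_path V F u p v \<and> set (butlast (tl p)) \<inter> L = {})"

lemma card_colors_used_le_tmc:
  assumes "simple_graph V E" "tmc_coloring V E vc ec"
  shows "card (colors_used V E vc ec) \<le> tmc V E"
proof -
  have fin: "finite V" "finite E" using simple_graph_finite[OF assms(1)] .
  have "card (colors_used V E vc ec) \<le> card V + card E" for vc :: "'a \<Rightarrow> nat" and ec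
    unfolding colors_used_def
    by (rule order_trans[OF card_Un_le]) (simp add: add_mono card_image_le fin)
  then have "{card (colors_used V E vc ec) | vc ec. tmc_coloring V E vc ec} \<subseteq> {..card V + card E}"
    by auto
  then have "finite {card (colors_used V E vc ec) | vc ec. tmc_coloring V E vc ec}"
    using finite_subset by blast
  then show ?thesis unfolding tmc_def using assms(2) by (intro Max_ge) auto
qed

lemma tmc_le:
  assumes "simple_graph V E" "connected_graph V E"
    and "\<And>vc ec. tmc_coloring V E vc ec \<Longrightarrow> card (colors_used V E vc ec) \<le> k"
  shows "tmc V E \<le> k"
proof -
  let ?A = "{card (colors_used V E vc ec) | vc ec. tmc_coloring V E vc ec}"
  \<comment> \<open>A constant coloring shows that the set is nonempty, so its maximum is
    attained.\<close>
  have "tmc_coloring V E (\<lambda>_. 0) (\<lambda>_. 0)"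
    using assms(2) by (auto simp: tmc_coloring_def total_mono_path_def connected_graph_def)
  then have "?A \<noteq> {}" by blast
  moreover have "?A \<subseteq> {..k}" using assms(3) by auto
  ultimately show ?thesis unfolding tmc_def
    by (metis (no_types, lifting) Max_in atMost_iff finite_atMost finite_subset subsetD)
qed

text \<open>Color 0 goes to \<open>F\<close> and \<open>V - L\<close>, and each remaining element
  gets a color of its own. Adjacent vertices need no path in \<open>F\<close>, because a single edge
  is total monochromatic whatever its color. The assumption \<open>ne\<close> ensures that color 0
  really occurs.\<close>

lemma tmc_lower_bound:
  assumes G: "simple_graph V E" and "F \<subseteq> E" "L \<subseteq> V" and ne: "F \<noteq> {} \<or> V - L \<noteq> {}"
    and link: "\<And>u v. u \<in> V \<Longrightarrow> v \<in> V \<Longrightarrow> u \<noteq> v \<Longrightarrow>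
      {u, v} \<in> E \<or> (\<exists>p. graph_path V F u p v \<and> set (butlast (tl p)) \<inter> L = {})"
  shows "1 + card L + card (E - F) \<le> tmc V E"
proof -
  have fin: "finite V" "finite E" using simple_graph_finite[OF G] .
  \<comment> \<open>One injection on the disjoint sum keeps vertex colors and edge colors apart;
    \<open>Suc\<close> then reserves 0 for the common color.\<close>
  let ?T = "L <+> (E - F)"
  have fT: "finite L" "finite (E - F)" "finite ?T"
    using fin \<open>L \<subseteq> V\<close> finite_subset by auto
  then obtain f :: "'a + 'a set \<Rightarrow> nat" where f: "inj_on f ?T"
    using finite_imp_inj_to_nat_seg by meson
  define vc where "vc v = (if v \<in> L then Suc (f (Inl v)) else 0)" for v
  define ec where "ec e = (if e \<in> F then 0 else Suc (f (Inr e)))" for e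
  have "tmc_coloring V E vc ec"
    unfolding tmc_coloring_def
  proof (intro ballI)
    fix u v assume uv: "u \<in> V" "v \<in> V"
    consider "u = v" | "u \<noteq> v" "{u, v} \<in> E"
      | p where "graph_path V F u p v" "set (butlast (tl p)) \<inter> L = {}"
      using link uv by blast
    then show "\<exists>p. total_mono_path V E vc ec u p v"
    proof cases
      case 1
      then have "total_mono_path V E vc ec u [u] v"
        using uv by (simp add: total_mono_path_def graph_path_singleton)
      then show ?thesis by blast
    next
      case 2
      then have "total_mono_path V E vc ec u [u, v] v"
        using uv by (simp add: total_mono_path_def graph_path_edge)
      then show ?thesis by blast
    next
      case 3
      then have "\<forall>e\<in>set (walk_edges p). ec e = 0" "\<forall>w\<in>set (butlast (tl p)). vc w = 0"
        by (auto simp: graph_path_def ec_def vc_def)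
      then have "total_mono_path V E vc ec u p v"
        using graph_path_mono[OF 3(1) \<open>F \<subseteq> E\<close>] by (auto simp: total_mono_path_def)
      then show ?thesis by blast
    qed
  qed
  then have le: "card (colors_used V E vc ec) \<le> tmc V E"
    by (rule card_colors_used_le_tmc[OF G])
  have "insert 0 (Suc ` f ` ?T) \<subseteq> colors_used V E vc ec"
  proof -
    have "0 \<in> colors_used V E vc ec"
    proof (cases "F = {}")
      case True
      with ne obtain v where "v \<in> V" "v \<notin> L" by blast
      then show ?thesis by (force simp: colors_used_def vc_def)
    next
      case False
      then obtain e where "e \<in> F" by blast
      then show ?thesis using \<open>F \<subseteq> E\<close> by (force simp: colors_used_def ec_def)
    qed
    moreover have "Suc (f t) \<in> colors_used V E vc ec" if "t \<in> ?T" for t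
      using that
    proof (rule PlusE)
      fix v assume v: "v \<in> L" "t = Inl v"
      then have "vc v = Suc (f t)" by (simp add: vc_def)
      then show ?thesis using v \<open>L \<subseteq> V\<close> unfolding colors_used_def
        by (metis UnI1 image_eqI subsetD)
    next
      fix e assume e: "e \<in> E - F" "t = Inr e"
      then have "ec e = Suc (f t)" by (simp add: ec_def)
      then show ?thesis using e unfolding colors_used_def
        by (metis DiffD1 UnI2 image_eqI)
    qed
    ultimately show ?thesis by auto
  qed
  moreover have "finite (colors_used V E vc ec)" using fin by (simp add: colors_used_def)
  ultimately have "card (insert 0 (Suc ` f ` ?T)) \<le> card (colors_used V E vc ec)"
    by (simp add: card_mono)
  moreover have "card (insert 0 (Suc ` f ` ?T)) = 1 + card L + card (E - F)"
    using f fT by (subst card_insert_disjoint) (auto simp: card_image card_Plus)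
  ultimately show ?thesis using le by simp
qed

section \<open>Growing a linked set vertex by vertex\<close>

text \<open>Paths to the pendant vertex \<open>z\<close> run through \<open>w\<close>, so
  \<open>w\<close> must leave \<open>L\<close>. In exchange \<open>z\<close> may enter
  \<open>L'\<close>, being internal to none of the chosen paths.\<close>

lemma linked_avoiding_extend_vertex:
  assumes link: "linked_avoiding W F L" and "w \<in> W" "z \<notin> W" "{w, z} \<in> F"
    and L': "L' \<inter> W \<subseteq> L - {w}"
  shows "linked_avoiding (insert z W) F L'"
  unfolding linked_avoiding_def
proof (intro ballI)
  fix u v assume uv: "u \<in> insert z W" "v \<in> insert z W"
  have old: "\<exists>p. graph_path W F u p v \<and> set (butlast (tl p)) \<inter> (L - {w}) = {}"
    if "u \<in> W" "v \<in> W" for u v using link that unfolding linked_avoiding_def by blast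
  have inner: "set (butlast (tl p)) \<inter> L' = {}"
    if "graph_path W F u p v" "set (butlast (tl p)) \<inter> (L - {w}) = {}" for u p v
  proof -
    have "set (butlast (tl p)) \<subseteq> W"
      using that(1) unfolding graph_path_def
      by (metis in_set_butlastD list.set_sel(2) subset_iff)
    then show ?thesis using that(2) L' by blast
  qed
  have wL': "w \<notin> L'" using \<open>w \<in> W\<close> L' by blast
  consider "u \<in> W" "v \<in> W" | "u \<in> W" "v = z" | "u = z" "v \<in> W" | "u = z" "v = z"
    using uv by blast
  then show "\<exists>p. graph_path (insert z W) F u p v \<and> set (butlast (tl p)) \<inter> L' = {}"
  proof cases
    case 1
    then obtain p where p: "graph_path W F u p v" "set (butlast (tl p)) \<inter> (L - {w}) = {}"
      using old by blast
    then have "graph_path (insert z W) F u p v" by (auto simp: graph_path_def)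
    then show ?thesis using inner[OF p] by blast
  next
    case 2
    then obtain p where p: "graph_path W F u p w" "set (butlast (tl p)) \<inter> (L - {w}) = {}"
      using old \<open>w \<in> W\<close> by blast
    have "graph_path (insert z W) F u (p @ [z]) z"
      using p(1) assms(3,4) by (auto simp: graph_path_def walk_edges_snoc)
    \<comment> \<open>Unless \<open>p\<close> is just \<open>[w]\<close>, appending \<open>z\<close>
      turns the end \<open>w\<close> of \<open>p\<close> into an internal vertex and adds no other
      one.\<close>
    moreover have "set (butlast (tl (p @ [z]))) \<inter> L' = {}"
    proof (cases "tl p = []")
      case True
      then show ?thesis using p(1) by (cases p) (auto simp: graph_path_def)
    next
      case False
      then have "tl p = butlast (tl p) @ [w]" using p(1)
        by (metis append_butlast_last_id graph_path_def last_tl)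
      then have "set (tl p) = insert w (set (butlast (tl p)))"
        by (metis list.simps(15) rotate1.simps(2) set_rotate1)
      moreover have "butlast (tl (p @ [z])) = tl p" using p(1)
        by (simp add: graph_path_def)
      ultimately show ?thesis using inner[OF p] wL' by auto
    qed
    ultimately show ?thesis using 2 by blast
  next
    case 3
    then obtain p where p: "graph_path W F w p v" "set (butlast (tl p)) \<inter> (L - {w}) = {}"
      using old \<open>w \<in> W\<close> by blast
    have "graph_path (insert z W) F z (z # p) v"
      using p(1) assms(3,4) by (auto simp: graph_path_def walk_edges_Cons insert_commute)
    moreover have "set (butlast (tl (z # p))) \<subseteq> insert w (set (butlast (tl p)))"
      using p(1) by (cases p) (auto simp: graph_path_def)
    ultimately show ?thesis using 3 inner[OF p] wL' by blast
  next
    case 4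
    then show ?thesis by (intro exI[of _ "[z]"]) (simp add: graph_path_singleton)
  qed
qed

text \<open>Attach the vertices outside \<open>W\<close> one at a time; whenever a vertex is attached to an element
  of \<open>L\<close>, it takes the place of that element.\<close>

lemma linked_avoiding_extend:
  assumes "finite V" "all_cuts_crossed V F"
    and "W \<subseteq> V" "W \<noteq> {}" "L \<subseteq> W" "linked_avoiding W F L"
  shows "\<exists>L'. L' \<subseteq> V \<and> card L' = card L \<and> linked_avoiding V F L'"
  using assms(3-)
proof (induction "card (V - W)" arbitrary: W L rule: less_induct)
  case less
  show ?case
  proof (cases "W = V")
    case True
    then show ?thesis using less.prems by blast
  next
    case False
    then obtain w z where wz: "{w, z} \<in> F" "w \<in> W" "z \<in> V - W"
      using assms(2) less.prems unfolding all_cuts_crossed_def by blast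
    define L' where "L' = (if w \<in> L then insert z (L - {w}) else L)"
    have fL: "finite L" using less.prems assms(1) finite_subset by metis
    have c: "card L' = card L"
      using fL wz less.prems(3) card_Suc_Diff1[of L w] by (auto simp: L'_def card_insert_if)
    have "card (V - insert z W) < card (V - W)"
      using wz assms(1) by (intro psubset_card_mono) auto
    moreover have "linked_avoiding (insert z W) F L'"
      using less.prems wz by (intro linked_avoiding_extend_vertex[where L = L and w = w])
        (auto simp: L'_def)
    moreover have "L' \<subseteq> insert z W" "insert z W \<subseteq> V"
      using wz less.prems by (auto simp: L'_def)
    ultimately show ?thesis using less.hyps[of "insert z W" L'] c by auto
  qed
qed

text \<open>The seed of the growth: two leaves of a star meet through its center \<open>x\<close>,
  which is not in \<open>A\<close>.\<close>

lemma star_linked_avoiding: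
  assumes "x \<notin> A" "\<And>a. a \<in> A \<Longrightarrow> {x, a} \<in> F"
  shows "linked_avoiding (insert x A) F A"
  unfolding linked_avoiding_def
proof (intro ballI)
  fix u v assume uv: "u \<in> insert x A" "v \<in> insert x A"
  consider "u = v" | "u \<noteq> v" "u = x \<or> v = x" | "u \<noteq> v" "u \<in> A" "v \<in> A" using uv by blast
  then show "\<exists>p. graph_path (insert x A) F u p v \<and> set (butlast (tl p)) \<inter> A = {}"
  proof cases
    case 1
    then show ?thesis using uv by (intro exI[of _ "[u]"]) (simp add: graph_path_singleton)
  next
    case 2
    then show ?thesis using uv assms
      by (intro exI[of _ "[u, v]"]) (auto simp: graph_path_def insert_commute)
  next
    case 3
    then show ?thesis using assms
      by (intro exI[of _ "[u, x, v]"]) (auto simp: graph_path_def insert_commute)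
  qed
qed

text \<open>The cycle edge \<open>{a, b}\<close> away from \<open>x\<close> can be left out of the connecting structure, so that it
  contributes a color of its own.\<close>

lemma tmc_ge_star_on_cycle:
  assumes G: "simple_graph V E" and "connected_graph V E"
    and c: "cycle_list (x # a # b # r)" "cycle_edges (x # a # b # r) \<subseteq> E"
    and A: "finite A" "A \<noteq> {}" "\<And>y. y \<in> A \<Longrightarrow> {x, y} \<in> E"
  shows "2 + card A \<le> tmc V E"
proof -
  define F where "F = E - {{a, b}}"
  have fin: "finite V" "finite E" using simple_graph_finite[OF G] .
  have ab: "{a, b} \<in> E" using c(2) by (simp add: cycle_edges_def)
  have x: "x \<noteq> a" "x \<noteq> b" using c(1) by (auto simp: cycle_list_def)
  have AV: "x \<in> V" "y \<in> V" "y \<noteq> x" if "y \<in> A" for y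
    using A(3)[OF that] G by (auto simp: simple_graph_def)
  have AF: "{x, y} \<in> F" if "y \<in> A" for y using A(3)[OF that] x by (auto simp: F_def doubleton_eq_iff)
  \<comment> \<open>The rest of the cycle, from \<open>b\<close> round to \<open>a\<close>. It
    replaces the deleted edge \<open>{a, b}\<close>.\<close>
  let ?q = "b # r @ [x, a]"
  have qF: "set (walk_edges ?q) \<subseteq> F"
  proof -
    have "walk_edges ?q = walk_edges (b # r @ [x]) @ [{x, a}]"
      using walk_edges_snoc[of "b # r @ [x]" a] by simp
    moreover have "set (walk_edges (b # r @ [x])) \<subseteq> E" "{x, a} \<in> E"
      using c(2) by (auto simp: cycle_edges_def)
    moreover have "{a, b} \<notin> set (walk_edges (b # r @ [x]))"
      using walk_edges_subset[of "{a, b}" "b # r @ [x]"] c(1) by (auto simp: cycle_list_def)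
    ultimately show ?thesis using x by (auto simp: F_def doubleton_eq_iff)
  qed
  have qV: "set ?q \<subseteq> V"
  proof -
    have "y \<in> V" if "e \<in> E" "y \<in> e" for e y using that G by (auto simp: simple_graph_def)
    \<comment> \<open>Every entry before the last lies on an edge of the walk; applied to the closed
      walk, this puts all cycle vertices into \<open>V\<close>.\<close>
    moreover have "\<exists>e\<in>set (walk_edges (xs @ [y])). v \<in> e" if "v \<in> set xs" for v :: 'a and xs y
      using that by (induction xs rule: walk_edges.induct) auto
    ultimately have "set (x # a # b # r) \<subseteq> V"
      using c(2) unfolding cycle_edges_def by (meson subset_iff)
    then show ?thesis by auto
  qed
  have "all_cuts_crossed V F"
    unfolding all_cuts_crossed_def
  proof (intro allI impI)
    fix S assume S: "S \<subset> V" "S \<noteq> {}"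
    then obtain u v where uv: "{u, v} \<in> E" "u \<in> S" "v \<in> V - S"
      using connected_graph_all_cuts_crossed[OF assms(2)] unfolding all_cuts_crossed_def by blast
    show "\<exists>x y. {x, y} \<in> F \<and> x \<in> S \<and> y \<in> V - S"
    proof (cases "{u, v} = {a, b}")
      case False
      then show ?thesis using uv by (auto simp: F_def)
    next
      case True
      \<comment> \<open>A cut separating \<open>a\<close> from \<open>b\<close> is also crossed by
        the detour \<open>?q\<close>. If \<open>b\<close> is outside \<open>S\<close>, the crossing
        is found for the complement and then reversed.\<close>
      have "\<exists>y z. {y, z} \<in> set (walk_edges ?q) \<and> y \<in> S \<and> z \<notin> S"
      proof (cases "b \<in> S")
        case T: True
        then have "a \<notin> S" using True uv by (auto simp: doubleton_eq_iff)
        then show ?thesis using T walk_edges_crossing[of ?q S] by simp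
      next
        case F: False
        then have "a \<in> S" using True uv by (auto simp: doubleton_eq_iff)
        then obtain y z where "{y, z} \<in> set (walk_edges ?q)" "y \<in> - S" "z \<notin> - S"
          using F walk_edges_crossing[of ?q "- S"] by auto
        then show ?thesis by (metis ComplD ComplI insert_commute)
      qed
      then obtain y z where yz: "{y, z} \<in> set (walk_edges ?q)" "y \<in> S" "z \<notin> S" by blast
      then have "z \<in> V" using walk_edges_subset[OF yz(1)] qV by blast
      then show ?thesis using yz qF by blast
    qed
  qed
  moreover have "linked_avoiding (insert x A) F A"
    using AV AF by (intro star_linked_avoiding) auto
  moreover have "insert x A \<subseteq> V" using AV A(2) by auto
  ultimately obtain L where L: "L \<subseteq> V" "card L = card A" "linked_avoiding V F L"
    using linked_avoiding_extend[OF fin(1), of F "insert x A" A] by auto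
  have "E - F = {{a, b}}" using ab by (auto simp: F_def)
  moreover have "F \<noteq> {}" using AF A(2) by auto
  ultimately show ?thesis
    using tmc_lower_bound[OF G, of F L] L by (auto simp: F_def linked_avoiding_def)
qed

section \<open>Upper bounds\<close>

text \<open>The vertices all of whose edges have the color of \<open>e\<close> form a set
  \<open>S\<close> closed under adjacency, so connectivity gives \<open>S = V\<close>.\<close>

lemma incident_edges_mono_imp_mono:
  assumes G: "simple_graph V E" and "connected_graph V E"
    and loc: "\<And>v e f. v \<in> V \<Longrightarrow> e \<in> E \<Longrightarrow> f \<in> E \<Longrightarrow> v \<in> e \<Longrightarrow> v \<in> f \<Longrightarrow> ec e = ec f"
    and "e \<in> E" "f \<in> E"
  shows "ec e = ec f"
proof -
  define S where "S = {v \<in> V. \<forall>f\<in>E. v \<in> f \<longrightarrow> ec f = ec e}"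
  have S: "v \<in> S" if "g \<in> E" "ec g = ec e" "v \<in> g" for g v
  proof -
    have "v \<in> V" using that G by (auto simp: simple_graph_def)
    then show ?thesis using loc[of v _ g] that by (simp add: S_def)
  qed
  obtain u v where e: "e = {u, v}" using simple_graph_edgeE[OF G \<open>e \<in> E\<close>] by metis
  have "S = V"
  proof (rule ccontr)
    assume "S \<noteq> V"
    then have "S \<subset> V" by (auto simp: S_def)
    moreover have "S \<noteq> {}" using S[OF \<open>e \<in> E\<close>] e by auto
    ultimately obtain x y where "{x, y} \<in> E" "x \<in> S" "y \<in> V - S"
      using connected_graph_all_cuts_crossed[OF assms(2)] unfolding all_cuts_crossed_def by blast
    moreover from this have "ec {x, y} = ec e" by (auto simp: S_def)
    ultimately show False using S[of "{x, y}" y] by auto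
  qed
  moreover obtain x y where xy: "f = {x, y}" "x \<in> V"
    using simple_graph_edgeE[OF G \<open>f \<in> E\<close>] by metis
  ultimately have "x \<in> S" by simp
  then show ?thesis using \<open>f \<in> E\<close> xy by (simp add: S_def)
qed

text \<open>If \<open>p\<close> missed \<open>v\<close>, then \<open>v\<close> would close it to a
  cycle. If \<open>p\<close> meets \<open>v\<close> but takes more than one edge before or after it,
  that segment closes up with \<open>{u, v}\<close> or \<open>{v, w}\<close>.\<close>

lemma acyclic_graph_path_two_neighbours:
  assumes ac: "acyclic_graph V E" and p: "graph_path V E u p w"
    and e: "{u, v} \<in> E" "{v, w} \<in> E" "v \<in> V" and ne: "u \<noteq> w" "u \<noteq> v" "v \<noteq> w"
  shows "p = [u, v, w]"
proof -
  have no: "\<not> (distinct q \<and> 3 \<le> length q \<and> set q \<subseteq> V \<and> {last q, hd q} \<in> E \<and>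
    set (walk_edges q) \<subseteq> E)" for q
    using ac cycle_edges_eq[of q] unfolding acyclic_graph_def cycle_list_def
    by (metis insert_subset list.size(3) not_numeral_le_zero)
  have pp: "p \<noteq> []" "hd p = u" "last p = w" "distinct p" "set p \<subseteq> V" "set (walk_edges p) \<subseteq> E"
    using p by (auto simp: graph_path_def)
  then have len: "length p \<ge> 2" using ne by (cases p rule: walk_edges.cases) auto
  have "v \<in> set p"
  proof (rule ccontr)
    assume "v \<notin> set p"
    then show False using no[of "v # p"] pp len e by (auto simp: walk_edges_Cons insert_commute)
  qed
  then obtain xs ys where p_eq: "p = xs @ v # ys" by (meson split_list)
  have E: "set (walk_edges (xs @ [v])) \<subseteq> E" "set (walk_edges (v # ys)) \<subseteq> E"
    using pp(6) unfolding p_eq walk_edges_append[of xs v ys] by auto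
  have "xs \<noteq> []" "ys \<noteq> []" using pp(2,3) ne(2,3) by (auto simp: p_eq)
  then have hl: "hd xs = u" "last ys = w" using pp(2,3) by (simp_all add: p_eq)
  have "length xs < 2"
  proof (rule ccontr)
    assume "\<not> length xs < 2"
    then show False using no[of "xs @ [v]"] pp(4,5) E e(1) hl \<open>xs \<noteq> []\<close>
      by (auto simp: p_eq insert_commute)
  qed
  then have "xs = [u]" using hl \<open>xs \<noteq> []\<close> by (cases xs) auto
  moreover have "length ys < 2"
  proof (rule ccontr)
    assume "\<not> length ys < 2"
    then show False using no[of "v # ys"] pp(4,5) E e(2) hl \<open>ys \<noteq> []\<close>
      by (auto simp: p_eq insert_commute)
  qed
  then have "ys = [w]" using hl \<open>ys \<noteq> []\<close> by (cases ys) auto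
  ultimately show ?thesis using p_eq by simp
qed


text \<open>Internal vertices are recast as the vertices of \<open>p\<close> other than its ends,
  which suits arguments that only know that a vertex lies on \<open>p\<close>.\<close>

lemma tmc_coloring_path:
  assumes "tmc_coloring V E vc ec" "u \<in> V" "v \<in> V"
  obtains p k where "graph_path V E u p v" "\<And>e. e \<in> set (walk_edges p) \<Longrightarrow> ec e = k"
    "\<And>w. w \<in> set p \<Longrightarrow> w \<noteq> u \<Longrightarrow> w \<noteq> v \<Longrightarrow> vc w = k"
proof -
  obtain p where p: "total_mono_path V E vc ec u p v"
    using assms unfolding tmc_coloring_def by blast
  then obtain k where k: "\<forall>e\<in>set (walk_edges p). ec e = k" "\<forall>w\<in>set (butlast (tl p)). vc w = k"
    unfolding total_mono_path_def by blast
  have g: "graph_path V E u p v" using p by (simp add: total_mono_path_def)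
  then have "vc w = k" if "w \<in> set p" "w \<noteq> u" "w \<noteq> v" for w
    using that set_inner[of w p] k(2) by (auto simp: graph_path_def)
  then show ?thesis using that g k(1) by blast
qed

subsection \<open>Trees\<close>

lemma connected_graph_incident_edge:
  assumes "connected_graph V E" "v \<in> V" "V \<noteq> {v}"
  shows "\<exists>w. {v, w} \<in> E"
proof -
  have "{v} \<subset> V" using assms by auto
  then show ?thesis
    using connected_graph_all_cuts_crossed[OF assms(1)] unfolding all_cuts_crossed_def by blast
qed

lemma vertex_degree_1_unique:
  assumes "vertex_degree E v = 1" "e \<in> E" "f \<in> E" "v \<in> e" "v \<in> f"
  shows "e = f"
proof -
  obtain g where "{e \<in> E. v \<in> e} = {g}"
    using assms(1) unfolding vertex_degree_def by (rule card_1_singletonE)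
  moreover have "e \<in> {e \<in> E. v \<in> e}" "f \<in> {e \<in> E. v \<in> e}" using assms(2-5) by simp_all
  ultimately show ?thesis by (metis singletonD)
qed

lemma tree_card_colors_le:
  assumes G: "simple_graph V E" and T: "tree_graph V E" and c: "tmc_coloring V E vc ec"
  shows "card (colors_used V E vc ec) \<le> 1 + num_leaves V E"
proof -
  have con: "connected_graph V E" and ac: "acyclic_graph V E"
    using T by (auto simp: tree_graph_def)
  have fin: "finite V" "finite E" using simple_graph_finite[OF G] .
  have edge: "x \<in> V" "y \<in> V" "x \<noteq> y" if "{x, y} \<in> E" for x y
    using that G by (auto simp: simple_graph_def)
  \<comment> \<open>The only path between two neighbours of \<open>v\<close> passes through
    \<open>v\<close>, so both edges and \<open>v\<close> share its color.\<close>
  have loc: "ec {v, u} = vc v \<and> ec {v, w} = vc v"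
    if e: "{v, u} \<in> E" "{v, w} \<in> E" "u \<noteq> w" for u v w
  proof -
    obtain p k where p: "graph_path V E u p w" "\<And>e. e \<in> set (walk_edges p) \<Longrightarrow> ec e = k"
      "\<And>x. x \<in> set p \<Longrightarrow> x \<noteq> u \<Longrightarrow> x \<noteq> w \<Longrightarrow> vc x = k"
      using tmc_coloring_path[OF c, of u w] edge e by metis
    have "p = [u, v, w]"
      using acyclic_graph_path_two_neighbours[OF ac p(1), of v] e edge[OF e(1)] edge[OF e(2)]
      by (auto simp: insert_commute)
    then show ?thesis
      using p(2)[of "{v, u}"] p(2)[of "{v, w}"] p(3)[of v] edge[OF e(1)] edge[OF e(2)]
      by (auto simp: insert_commute)
  qed
  have loc2: "ec e = vc v \<and> ec f = vc v"
    if ef: "e \<in> E" "f \<in> E" "v \<in> e" "v \<in> f" "e \<noteq> f" for e f v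
  proof -
    obtain u w where "e = {v, u}" "f = {v, w}"
      using simple_graph_edge_at[OF G] ef by metis
    then show ?thesis using loc[of v u w] ef by auto
  qed
  have mono: "ec e = ec f" if "e \<in> E" "f \<in> E" for e f
  proof (rule incident_edges_mono_imp_mono[OF G con _ that])
    show "ec g = ec h" if "v \<in> V" "g \<in> E" "h \<in> E" "v \<in> g" "v \<in> h" for v g h
      using loc2[of g h v] that by metis
  qed
  show ?thesis
  proof (cases "E = {}")
    case True
    have "V \<noteq> {}" using con by (simp add: connected_graph_def)
    then obtain v where "v \<in> V" by blast
    then have "V = {v}" using connected_graph_incident_edge[OF con] True by blast
    then show ?thesis using True by (simp add: colors_used_def)
  next
    case False
    then obtain e0 where e0: "e0 \<in> E" by blast
    define L where "L = {v \<in> V. vertex_degree E v = 1}"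
    have "vc v = ec e0" if v: "v \<in> V" "v \<notin> L" for v
    proof -
      have "V \<noteq> {v}" using simple_graph_edgeE[OF G e0] by (metis singletonD)
      then obtain w where w: "{v, w} \<in> E" using connected_graph_incident_edge[OF con v(1)] by blast
      \<comment> \<open>A vertex that has an edge and is not a leaf has a second edge, so
        \<open>loc2\<close> applies to it.\<close>
      have "{e \<in> E. v \<in> e} \<noteq> {{v, w}}"
        using v unfolding L_def vertex_degree_def by fastforce
      then obtain f where "f \<in> E" "v \<in> f" "f \<noteq> {v, w}" using w by blast
      then show ?thesis using loc2[of "{v, w}" f v] w mono[OF w e0] by auto
    qed
    then have "colors_used V E vc ec \<subseteq> insert (ec e0) (vc ` L)"
      using mono[OF _ e0] by (auto simp: colors_used_def)
    then have "card (colors_used V E vc ec) \<le> card (insert (ec e0) (vc ` L))"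
      using fin by (intro card_mono) (auto simp: L_def)
    also have "\<dots> \<le> Suc (card (vc ` L))" using fin by (simp add: card_insert_if L_def)
    also have "card (vc ` L) \<le> card L" using fin by (intro card_image_le) (simp add: L_def)
    finally show ?thesis by (simp add: num_leaves_def L_def)
  qed
qed

lemma tree_tmc:
  assumes G: "simple_graph V E" and T: "tree_graph V E"
  shows "tmc V E = 1 + num_leaves V E"
proof (rule antisym)
  have con: "connected_graph V E" using T by (simp add: tree_graph_def)
  show "tmc V E \<le> 1 + num_leaves V E"
    using tmc_le[OF G con] tree_card_colors_le[OF G T] by blast
  define L where "L = {v \<in> V. vertex_degree E v = 1}"
  have "\<exists>p. graph_path V E u p v \<and> set (butlast (tl p)) \<inter> L = {}" if uv: "u \<in> V" "v \<in> V" for u v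
  proof -
    obtain p where p: "graph_path V E u p v" using con uv by (auto simp: connected_graph_def)
    have "x \<notin> L" if x: "x \<in> set (butlast (tl p))" for x
    proof
      \<comment> \<open>An internal vertex of a path lies on two distinct edges of the path, so its
        degree is not 1.\<close>
      assume "x \<in> L"
      obtain ys y z zs where "p = ys @ y # x # z # zs" using in_inner_split[OF x] by blast
      then have "{y, x} \<in> E" "{x, z} \<in> E" "y \<noteq> z" "y \<noteq> x"
        using p walk_edges_append[of ys y "x # z # zs"] by (auto simp: graph_path_def)
      then show False using \<open>x \<in> L\<close> vertex_degree_1_unique[of E x "{y, x}" "{x, z}"]
        by (auto simp: L_def doubleton_eq_iff)
    qed
    then show ?thesis using p by blast
  qed
  \<comment> \<open>Without edges every vertex has degree 0 and is not counted as a leaf.\<close>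
  moreover have "E \<noteq> {} \<or> V - L \<noteq> {}"
  proof -
    obtain v where v: "v \<in> V" using con by (auto simp: connected_graph_def)
    show ?thesis
    proof (cases "E = {}")
      case True
      then show ?thesis using v by (auto simp: L_def vertex_degree_def)
    qed simp
  qed
  ultimately show "1 + num_leaves V E \<le> tmc V E"
    using tmc_lower_bound[OF G, of E L] by (auto simp: num_leaves_def L_def)
qed

text \<open>An edge missing from \<open>F\<close> would close the path in \<open>F\<close> between
  its ends to a cycle in \<open>E\<close>. Hence the maximum over spanning trees has a single
  candidate.\<close>

lemma spanning_tree_of_tree:
  assumes G: "simple_graph V E" and T: "tree_graph V E" and F: "F \<subseteq> E" "tree_graph V F"
  shows "F = E"
proof (rule ccontr)
  assume "F \<noteq> E"
  then obtain e where e: "e \<in> E" "e \<notin> F" using F by blast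
  obtain u v where uv: "e = {u, v}" "u \<noteq> v" "u \<in> V" "v \<in> V"
    using simple_graph_edgeE[OF G e(1)] by metis
  then obtain p where p: "graph_path V F u p v"
    using F(2) by (auto simp: tree_graph_def connected_graph_def)
  have "length p \<ge> 3"
  proof (rule ccontr)
    assume "\<not> length p \<ge> 3"
    then have "length p < 3" by simp
    then have "p = [u, v]" using p uv(2)
      by (cases p rule: walk_edges.cases) (auto simp: graph_path_def)
    then show False using p e uv by (simp add: graph_path_def)
  qed
  moreover have "cycle_edges p \<subseteq> E"
    using cycle_edges_eq[of p] p e uv F(1) by (auto simp: graph_path_def insert_commute)
  ultimately show False
    using T p by (auto simp: tree_graph_def acyclic_graph_def cycle_list_def graph_path_def)
qed

lemma tree_max_leaves:
  assumes "simple_graph V E" "tree_graph V E"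
  shows "max_leaves V E = num_leaves V E"
proof -
  have "{num_leaves V F | F. F \<subseteq> E \<and> tree_graph V F} = {num_leaves V E}"
    using spanning_tree_of_tree[OF assms] assms(2) by blast
  then show ?thesis by (simp add: max_leaves_def)
qed

subsection \<open>Cycles\<close>

text \<open>If the short path from \<open>a\<close> to \<open>c\<close> through \<open>b\<close> is not monochromatic, then the one joining them
  misses \<open>{a, b}\<close> or \<open>{b, c}\<close>, and hence contains every edge that forms a cut with the missed one.\<close>

lemma cycle_two_apart:
  assumes E: "E = cycle_edges (a # b # c # qs)" and V: "V = set (a # b # c # qs)"
    and d: "distinct (a # b # c # qs)" and tc: "tmc_coloring V E vc ec"
  shows "(ec {a, b} = vc b \<and> ec {b, c} = vc b) \<or>
    (\<exists>k. (\<forall>e\<in>set (walk_edges (c # qs @ [a])). ec e = k) \<and> (\<forall>v\<in>set qs. vc v = k))"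
proof -
  obtain p k where p: "graph_path V E a p c" "\<And>e. e \<in> set (walk_edges p) \<Longrightarrow> ec e = k"
    "\<And>w. w \<in> set p \<Longrightarrow> w \<noteq> a \<Longrightarrow> w \<noteq> c \<Longrightarrow> vc w = k"
    using tmc_coloring_path[OF tc, of a c] V by auto
  have pp: "p \<noteq> []" "hd p = a" "last p = c" "set (walk_edges p) \<subseteq> E"
    using p(1) by (auto simp: graph_path_def)
  have Eq: "E = insert {a, b} (insert {b, c} (set (walk_edges (c # qs @ [a]))))"
    by (simp add: E cycle_edges_def)
  show ?thesis
  proof (cases "{a, b} \<in> set (walk_edges p) \<and> {b, c} \<in> set (walk_edges p)")
    case True
    then have "b \<in> set p" using walk_edges_subset by blast
    then have "vc b = k" using p(3)[of b] d by auto
    then show ?thesis using True p(2) by auto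
  next
    case False
    \<comment> \<open>Cutting the long way at \<open>{x, y}\<close> gives two sets containing
      \<open>a\<close> but not \<open>c\<close>: the part from \<open>y\<close> to \<open>a\<close>,
      with or without \<open>b\<close>. Their boundaries are \<open>{x, y}\<close> with
      \<open>{b, c}\<close> or with \<open>{a, b}\<close>. As \<open>p\<close> misses one of the
      latter edges, it uses \<open>{x, y}\<close>.\<close>
    have long: "{x, y} \<in> set (walk_edges p)" if xy: "c # qs @ [a] = xs @ x # y # ys" for xs x y ys
    proof -
      have dd: "set (xs @ [x]) \<inter> set (y # ys) = {}" "b \<notin> set (xs @ [x])" "b \<notin> set (y # ys)"
        using d arg_cong[OF xy, of distinct] arg_cong[OF xy, of set] by auto
      have cx: "c \<in> set (xs @ [x])" using xy by (cases xs) auto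
      have ay: "a \<in> set (y # ys)" using arg_cong[OF xy, of last] by (auto split: if_splits)
      have Ed: "E = {{a, b}, {b, c}, {x, y}} \<union> set (walk_edges (xs @ [x])) \<union> set (walk_edges (y # ys))"
        unfolding Eq xy walk_edges_append[of xs x "y # ys"] by auto
      have cross: "{x, y} \<in> set (walk_edges p) \<or> {b, c} \<in> set (walk_edges p)"
      proof -
        let ?S = "insert b (set (y # ys))"
        have "c \<notin> ?S" using cx dd d by auto
        then obtain u v where uv: "{u, v} \<in> set (walk_edges p)" "u \<in> ?S" "v \<notin> ?S"
          using walk_edges_crossing[of p ?S] pp ay by auto
        have "{u, v} \<notin> set (walk_edges (xs @ [x]))"
          using walk_edges_subset[of "{u, v}" "xs @ [x]"] uv dd by auto
        moreover have "{u, v} \<notin> set (walk_edges (y # ys))"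
          using walk_edges_subset[of "{u, v}" "y # ys"] uv by auto
        moreover have "{u, v} \<noteq> {a, b}" using uv ay by (auto simp: doubleton_eq_iff)
        ultimately show ?thesis using uv pp(4) Ed by auto
      qed
      have cross': "{x, y} \<in> set (walk_edges p) \<or> {a, b} \<in> set (walk_edges p)"
      proof -
        let ?S = "set (y # ys)"
        have "c \<notin> ?S" using cx dd d by auto
        then obtain u v where uv: "{u, v} \<in> set (walk_edges p)" "u \<in> ?S" "v \<notin> ?S"
          using walk_edges_crossing[of p ?S] pp ay by auto
        have "{u, v} \<notin> set (walk_edges (xs @ [x]))"
          using walk_edges_subset[of "{u, v}" "xs @ [x]"] uv dd by auto
        moreover have "{u, v} \<notin> set (walk_edges (y # ys))"
          using walk_edges_subset[of "{u, v}" "y # ys"] uv by auto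
        moreover have "{u, v} \<noteq> {b, c}" using uv dd \<open>c \<notin> ?S\<close> by (auto simp: doubleton_eq_iff)
        ultimately show ?thesis using uv pp(4) Ed by auto
      qed
      show ?thesis using cross cross' False by blast
    qed
    have "e \<in> set (walk_edges p)" if e: "e \<in> set (walk_edges (c # qs @ [a]))" for e
      using in_walk_edges_split[OF e] long by blast
    moreover have "v \<in> set p" if v: "v \<in> set qs" for v
    proof -
      obtain ys zs where "qs = ys @ v # zs" using v by (meson split_list)
      then obtain y ys' where "c # qs @ [a] = (c # ys) @ v # y # ys'"
        by (cases zs) auto
      then show ?thesis using long walk_edges_subset by blast
    qed
    ultimately show ?thesis using p(2,3) d
      by (intro disjI2 exI[of _ k]) auto
  qed
qed

text \<open>The dichotomy of \<open>cycle_two_apart\<close> is used at \<open>b\<close> and then at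
  the next vertex \<open>c\<close>. The first use leaves six possible colors, and either outcome of
  the second identifies two of them with \<open>k\<close>.\<close>

lemma cycle_card_colors_le:
  assumes cyc: "cycle_graph V E" and card: "card V \<ge> 4"
    and G: "simple_graph V E" and con: "connected_graph V E" and tc: "tmc_coloring V E vc ec"
  shows "card (colors_used V E vc ec) \<le> 4"
proof -
  obtain p where p: "cycle_list p" "V = set p" "E = cycle_edges p"
    using cyc by (auto simp: cycle_graph_def)
  have bound: "card (colors_used V E vc ec) \<le> 4" if "colors_used V E vc ec \<subseteq> {k, l, m, n}" for k l m n
  proof -
    have "card (colors_used V E vc ec) \<le> card {k, l, m, n}" using that by (intro card_mono) auto
    also have "\<dots> \<le> 4" by (auto simp: card_insert_if)
    finally show ?thesis .
  qed
  \<comment> \<open>The cycle is listed with \<open>b\<close> in second place; the fourth vertex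
    \<open>d\<close> exists because the length is at least 4.\<close>
  have rot: "\<exists>a c d rs. V = set (a # b # c # d # rs) \<and> E = cycle_edges (a # b # c # d # rs) \<and>
    distinct (a # b # c # d # rs)" if b: "b \<in> V" for b
  proof -
    obtain c d r where q: "cycle_list (b # c # d # r)" "set (b # c # d # r) = V"
      "cycle_edges (b # c # d # r) = E"
      using cycle_list_rotate_to[OF p(1)] b p by metis
    then have "length (b # c # d # r) \<ge> 4"
      using card by (metis cycle_list_def distinct_card)
    then obtain rs a where r: "r = rs @ [a]"
      by (cases r rule: rev_cases) auto
    have "rotate1 (a # b # c # d # rs) = b # c # d # r" by (simp add: r)
    then have "cycle_edges (a # b # c # d # rs) = E"
      using q cycle_edges_rotate1 by metis
    then show ?thesis using q r by (intro exI[of _ a] exI[of _ c] exI[of _ d] exI[of _ rs])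
      (simp add: cycle_list_def; blast)
  qed
  show ?thesis
  proof (cases "\<forall>v\<in>V. \<forall>e\<in>E. v \<in> e \<longrightarrow> ec e = vc v")
    case True
    have mono: "ec e = ec f" if "e \<in> E" "f \<in> E" for e f
    proof (rule incident_edges_mono_imp_mono[OF G con _ that])
      show "ec g = ec h" if "v \<in> V" "g \<in> E" "h \<in> E" "v \<in> g" "v \<in> h" for v g h
        using True that by metis
    qed
    have "p \<noteq> []" using p(1) by (auto simp: cycle_list_def)
    then obtain e0 where e0: "e0 \<in> E" using p(3) cycle_edges_eq by blast
    have "vc v = ec e0" if v: "v \<in> V" for v
    proof -
      have "V \<noteq> {v}" using card by auto
      then obtain w where "{v, w} \<in> E" using connected_graph_incident_edge[OF con v] by blast
      then show ?thesis using True v mono[OF _ e0] by (metis insertI1)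
    qed
    then have "colors_used V E vc ec \<subseteq> {ec e0, ec e0, ec e0, ec e0}"
      using mono[OF _ e0] by (auto simp: colors_used_def)
    then show ?thesis by (rule bound)
  next
    case False
    then obtain b e where b: "b \<in> V" "e \<in> E" "b \<in> e" "ec e \<noteq> vc b" by blast
    obtain a c d rs where q: "V = set (a # b # c # d # rs)" "E = cycle_edges (a # b # c # d # rs)"
      "distinct (a # b # c # d # rs)" using rot[OF b(1)] by blast
    have Eq: "E = insert {a, b} (insert {b, c} (set (walk_edges (c # (d # rs) @ [a]))))"
      by (simp add: q(2) cycle_edges_def)
    have "e \<notin> set (walk_edges (c # (d # rs) @ [a]))"
      using walk_edges_subset[of e "c # (d # rs) @ [a]"] b q(3) by auto
    then have "e = {a, b} \<or> e = {b, c}" using b Eq by auto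
    then have "\<not> (ec {a, b} = vc b \<and> ec {b, c} = vc b)" using b by auto
    then obtain k where k: "\<forall>e\<in>set (walk_edges (c # (d # rs) @ [a])). ec e = k" "\<forall>v\<in>set (d # rs). vc v = k"
      using cycle_two_apart[OF q(2,1,3) tc] by blast
    have cov: "colors_used V E vc ec \<subseteq> {k, ec {a, b}, ec {b, c}, vc a, vc b, vc c}"
      unfolding colors_used_def q(1) Eq using k by auto
    \<comment> \<open>Rotating by one step moves from the pair \<open>a\<close>, \<open>c\<close> to
      the pair \<open>b\<close>, \<open>d\<close>.\<close>
    have r: "rotate1 (a # b # c # d # rs) = b # c # d # (rs @ [a])" by simp
    have q': "E = cycle_edges (b # c # d # (rs @ [a]))" "V = set (b # c # d # (rs @ [a]))"
      "distinct (b # c # d # (rs @ [a]))"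
      using q cycle_edges_rotate1[of "a # b # c # d # rs"] unfolding r by auto
    from cycle_two_apart[OF q' tc] show ?thesis
    proof
      assume "ec {b, c} = vc c \<and> ec {c, d} = vc c"
      then have "ec {b, c} = k" "vc c = k" using k(1) by auto
      then have "colors_used V E vc ec \<subseteq> {k, ec {a, b}, vc a, vc b}" using cov by auto
      then show ?thesis by (rule bound)
    next
      assume "\<exists>k. (\<forall>e\<in>set (walk_edges (d # (rs @ [a]) @ [b])). ec e = k) \<and> (\<forall>v\<in>set (rs @ [a]). vc v = k)"
      then obtain k' where k': "\<forall>e\<in>set (walk_edges (d # (rs @ [a]) @ [b])). ec e = k'" "vc a = k'" by auto
      have w: "walk_edges (d # (rs @ [a]) @ [b]) = walk_edges (d # rs @ [a]) @ [{a, b}]"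
        using walk_edges_snoc[of "d # rs @ [a]" b] by simp
      \<comment> \<open>The two long ways overlap in the walk from \<open>d\<close> to
        \<open>a\<close>, which has an edge even when \<open>rs\<close> is empty; hence
        \<open>k' = k\<close>.\<close>
      obtain f where f: "f \<in> set (walk_edges (d # rs @ [a]))" by (cases rs) auto
      then have "ec f = k" "ec f = k'" using k(1) k'(1) w by auto
      then have "ec {a, b} = k" "vc a = k" using k' w by auto
      then have "colors_used V E vc ec \<subseteq> {k, ec {b, c}, vc b, vc c}" using cov by auto
      then show ?thesis by (rule bound)
    qed
  qed
qed

lemma cycle_neighbours:
  assumes "cycle_list (x # a # b # r)"
  shows "{x, a} \<in> cycle_edges (x # a # b # r)" "{x, last (b # r)} \<in> cycle_edges (x # a # b # r)"
    "a \<noteq> last (b # r)"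
proof -
  show "{x, a} \<in> cycle_edges (x # a # b # r)" by (simp add: cycle_edges_def)
  show "{x, last (b # r)} \<in> cycle_edges (x # a # b # r)"
    by (simp add: cycle_edges_eq insert_commute)
  show "a \<noteq> last (b # r)"
    using assms last_in_set[of "b # r"] by (auto simp: cycle_list_def simp del: last.simps)
qed

lemma cycle_tmc:
  assumes cyc: "cycle_graph V E" and card: "card V \<ge> 4"
    and G: "simple_graph V E" and con: "connected_graph V E"
  shows "tmc V E = 4"
proof (rule antisym)
  show "tmc V E \<le> 4"
    using tmc_le[OF G con] cycle_card_colors_le[OF cyc card G con] by blast
  obtain p where p: "cycle_list p" "E = cycle_edges p"
    using cyc by (auto simp: cycle_graph_def)
  then have "p \<noteq> []" by (auto simp: cycle_list_def)
  then obtain x where "x \<in> set p" by (cases p) auto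
  then obtain a b r where q: "cycle_list (x # a # b # r)" "cycle_edges (x # a # b # r) = E"
    using cycle_list_rotate_to[OF p(1)] p(2) by metis
  \<comment> \<open>The star at \<open>x\<close> consists of its two neighbours on the
    cycle.\<close>
  then show "4 \<le> tmc V E"
    using tmc_ge_star_on_cycle[OF G con q(1), of "{a, last (b # r)}"] cycle_neighbours[OF q(1)]
    by (auto simp del: last.simps)
qed

section \<open>Cyclic graphs with at least five colors\<close>

text \<open>All vertices are pairwise adjacent, so \<open>L\<close> may be all of \<open>V\<close>.
  With \<open>F\<close> a single edge this even yields 1 + 3 + 2 = 6 colors.\<close>

lemma triangle_tmc:
  assumes cyc: "cycle_graph V E" and card: "card V = 3" and G: "simple_graph V E"
  shows "5 \<le> tmc V E"
proof -
  obtain p where p: "cycle_list p" "V = set p" "E = cycle_edges p"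
    using cyc by (auto simp: cycle_graph_def)
  then have "length p = 3" using card by (metis cycle_list_def distinct_card)
  then obtain a b c where "p = [a, b, c]" by (auto simp: numeral_3_eq_3 length_Suc_conv)
  then have V: "V = {a, b, c}" and E: "E = {{a, b}, {b, c}, {c, a}}" and d: "a \<noteq> b" "b \<noteq> c" "a \<noteq> c"
    using p by (auto simp: cycle_edges_def cycle_list_def)
  have "E - {{a, b}} = {{b, c}, {c, a}}" "{b, c} \<noteq> {c, a}" using d E by (auto simp: doubleton_eq_iff)
  then have "card (E - {{a, b}}) = 2" by simp
  moreover have "{u, v} \<in> E" if "u \<in> V" "v \<in> V" "u \<noteq> v" for u v
    using that V E by (auto simp: insert_commute)
  ultimately show ?thesis using tmc_lower_bound[OF G, of "{{a, b}}" V] card E by simp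
qed

text \<open>Some cycle vertex \<open>x\<close> has an edge off the cycle. Its other end and the two
  cycle neighbours of \<open>x\<close> form a star with three leaves, giving 2 + 3 colors.\<close>

lemma cyclic_not_cycle_graph_tmc:
  assumes G: "simple_graph V E" and con: "connected_graph V E"
    and nc: "\<not> cycle_graph V E" and p: "cycle_list p" "set p \<subseteq> V" "cycle_edges p \<subseteq> E"
  shows "5 \<le> tmc V E"
proof -
  have "\<exists>x y. {x, y} \<in> E \<and> {x, y} \<notin> cycle_edges p \<and> x \<in> set p"
  \<comment> \<open>The extra edge is a chord if the cycle spans \<open>V\<close>; otherwise
    connectivity provides an edge leaving the cycle.\<close>
  proof (cases "set p = V")
    case True
    with nc p have "E \<noteq> cycle_edges p" by (auto simp: cycle_graph_def)
    then obtain e where e: "e \<in> E" "e \<notin> cycle_edges p" using p(3) by blast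
    then show ?thesis using simple_graph_edgeE[OF G e(1)] True by metis
  next
    case False
    have "set p \<noteq> {}" using p(1) by (auto simp: cycle_list_def)
    then obtain x y where "{x, y} \<in> E" "x \<in> set p" "y \<in> V - set p"
      using connected_graph_all_cuts_crossed[OF con] False p(2) unfolding all_cuts_crossed_def
      by (metis psubsetI)
    then show ?thesis using cycle_edges_subset[of "{x, y}" p] by blast
  qed
  then obtain x y where xy: "{x, y} \<in> E" "{x, y} \<notin> cycle_edges p" "x \<in> set p" by blast
  obtain a b r where q: "cycle_list (x # a # b # r)" "cycle_edges (x # a # b # r) = cycle_edges p"
    using cycle_list_rotate_to[OF p(1) xy(3)] by metis
  define z where "z = last (b # r)"
  have z: "{x, a} \<in> cycle_edges p" "{x, z} \<in> cycle_edges p" "a \<noteq> z"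
    using cycle_neighbours[OF q(1)] q(2) by (simp_all add: z_def)
  then have "a \<noteq> y" "z \<noteq> y" using xy by blast+
  then have "card {a, z, y} = 3" using z(3) by simp
  moreover have "2 + card {a, z, y} \<le> tmc V E"
    using tmc_ge_star_on_cycle[OF G con q(1), of "{a, z, y}"] z xy p(3) q(2) by auto
  ultimately show ?thesis by simp
qed

theorem theorem4:
  fixes V :: "'a set" and E :: "'a set set"
  assumes "simple_graph V E" and "connected_graph V E"
  shows "tmc V E = 4 \<longleftrightarrow>
    (tree_graph V E \<and> max_leaves V E = 3) \<or> (cycle_graph V E \<and> card V \<ge> 4)"
proof (cases "tree_graph V E")
  case True
  then have "\<not> cycle_graph V E"
    unfolding tree_graph_def acyclic_graph_def cycle_graph_def by blast
  then show ?thesis using tree_tmc[OF assms(1) True] tree_max_leaves[OF assms(1) True] True by auto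
next
  case False
  then obtain p where p: "cycle_list p" "set p \<subseteq> V" "cycle_edges p \<subseteq> E"
    using assms(2) by (auto simp: tree_graph_def acyclic_graph_def)
  \<comment> \<open>Off trees the value is 4 exactly on cycles of length at least 4; the triangle
    and all graphs that are not cycles reach at least 5.\<close>
  show ?thesis
  proof (cases "cycle_graph V E")
    case True
    then obtain q where "cycle_list q" "V = set q" by (auto simp: cycle_graph_def)
    then have "card V \<ge> 3" by (simp add: cycle_list_def distinct_card)
    then consider "card V = 3" | "card V \<ge> 4" by linarith
    then show ?thesis
      using triangle_tmc[OF True _ assms(1)] cycle_tmc[OF True _ assms] False True by cases auto
  next
    case nc: False
    then show ?thesis using cyclic_not_cycle_graph_tmc[OF assms nc p] False by auto
  qed
qed

end
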